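(* Let $f_e$ and $f_g$ be functions satisfying Assumption I (listed in the context), let $\lambda_g>0$, $\lambda_e>0$, and let $\mathbf b\in\mathbb R^N$ with group vectors $\mathbf b_1,\dots,\mathbf b_{N_g}$ with respect to a partition $\{\mathcal I_i\}_{i=1}^{N_g}$ of $\{1,\dots,N\}$. Consider the optimization problem $$\hat{\mathbf a}=\operatorname*{argmin}_{\mathbf a\in\mathbb R^N}\left\{\frac12\|\mathbf b-\mathbf a\|_2^2+\sum_{j=1}^{N_g}f_g(\|\mathbf a_j\|_2;\lambda_g)+\sum_{i=1}^{N}f_e(a[i];\lambda_e)\right\}.$$ This problem can be decoupled over the groups: $\hat{\mathbf a}=\sum_{i=1}^{N_g}\hat{\mathbf a}_i$, where for $i=1,\dots,N_g$ $$\hat{\mathbf a}_i=\operatorname*{argmin}_{\mathbf a_i\in\mathbb R^N}\left\{\frac12\|\mathbf b_i-\mathbf a_i\|_2^2+g(\mathbf a_i;\lambda_g)+E(\mathbf a_i;\lambda_e)\right\},$$ with $g(\mathbf a_i;\lambda_g)=f_g(\|\mathbf a_i\|_2;\lambda_g)$ and $E(\mathbf a_i;\lambda_e)=\sum_j f_e(\mathbf a_i[j];\lambda_e)$. Moreover, for every $i$, $$\hat{\mathbf a}_i=P_{\lambda_g,g}\left(P_{\lambda_e,E}(\mathbf b_i)\right),$$ where the proximity operators $P_{\lambda_g,g}$ and $P_{\lambda_e,E}$ of $g$ and $E$ can be written, for a vector $\mathbf b$, as $$P_{\lambda_g,g}(\mathbf b)=\frac{P_{\lambda_g,f_g}(\|\mathbf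 b\|_2)}{\|\mathbf b\|_2}\,\mathbf b,\qquad [P_{\lambda_e,E}(\mathbf b)]_j=P_{\lambda_e,f_e}(b[j]),$$ the first expression being understood as $\mathbf 0$ when $\mathbf b=\mathbf 0$.
   Context: **Proximity operator.** For a continuous real-valued function $\phi(\mathbf a;\lambda)$ of $\mathbf a\in\mathbb R^N$ and $\lambda>0$, the proximity operator is $$P_{\lambda,\phi}(\mathbf b):=\operatorname*{argmin}_{\mathbf a\in\mathbb R^N}\left\{\tfrac12\|\mathbf b-\mathbf a\|_2^2+\phi(\mathbf a;\lambda)\right\},\quad \mathbf b\in\mathbb R^N.$$ For a univariate function $f(x;\lambda)$ this is used with $N=1$. (The minimizer is unique when the objective is strictly convex.) **Group vectors.** $\{\mathcal I_i\}_{i=1}^{N_g}$ is a partition of $\{1,\dots,N\}$ (disjoint sets with union $\{1,\dots,N\}$). For $\mathbf a\in\mathbb R^N$ the group vector $\mathbf a_i\in\mathbb R^N$ is defined by $\mathbf a_i[k]=\mathbf a[k]$ if $k\in\mathcal I_i$ and $\mathbf a_i[k]=0$ otherwise, so $\mathbf a=\sum_{i=1}^{N_g}\mathbf a_i$. The entries of $\mathbf a$ are written $a[i]$. **Assumption I.** $f_g,f_e:\mathbb R\to\mathbb R$ are continuous functions of $x$, depending on a regularization parameter $\lambda$ and written $f_k(x;\lambda)$, such that for $k\in\{e,g\}$: (i) $f_k$ is a non-decreasing function of $x$ for $x\ge0$; $f_k(0;\lambda)=0$; and $f_k(x;0)=0$. (ii) $f_k$ is differentiable (in $x$) except at $x=0$.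 (iii) For all $z\in\partial f_k(0;\lambda)$, $|z|\le\lambda$, where $\partial f_k(0;\lambda)$ is the subgradient set of $f_k(\cdot;\lambda)$ at zero (in the sense of Rockafellar–Wets, Variational Analysis). (iv) There exists $\mu\le\frac12$ such that the function $x\mapsto f_k(x;\lambda)+\mu x^2$ is convex. (v) $f_g$ is homogeneous: $f_g(\alpha x;\alpha\lambda)=\alpha^2f_g(x;\lambda)$ for all $\alpha>0$. (vi) $f_e$ is scale invariant: $f_e(\alpha x;\lambda)=f_e(x;\alpha\lambda)=\alpha f_e(x;\lambda)$ for all $\alpha>0$.
   Formalization: Adds the assumption that 0 is a subgradient of f_g(·;λ_g) and of f_e(·;λ_e) at 0 (true for even penalties); without it the claim fails, e.g. f_e(x;λ)=λx, f_g=0, b=0, two groups. Argmins and proximity operators are read as sets of minimizers. *)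

theory Defs
  imports "HOL-Analysis.Analysis"
begin

text \<open>The set of all global minimizers. It is kept set-valued because the objectives
below need not be strictly convex in the boundary case \<open>\<mu> = 1/2\<close>.\<close>

definition argmin :: "('a \<Rightarrow> real) \<Rightarrow> 'a set" where
  "argmin F = {a. is_arg_min F (\<lambda>_. True) a}"

definition prox :: "real \<Rightarrow> ('a::real_normed_vector \<Rightarrow> real \<Rightarrow> real) \<Rightarrow> 'a \<Rightarrow> 'a set" where
  "prox l \<phi> b = argmin (\<lambda>a. 1/2 * (norm (b - a))\<^sup>2 + \<phi> a l)"

definition group_vec :: "'n set \<Rightarrow> real ^ 'n \<Rightarrow> real ^ 'n" where
  "group_vec S a = (\<chi> k. if k \<in> S then a $ k else 0)"

text \<open>Subgradients in the sense of Rockafellar and Wets, Definition 8.3: regular subgradients,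
and (general, limiting) subgradients as limits of regular subgradients along
\<open>f\<close>-attentively convergent sequences.\<close>

definition regular_subgradients :: "(real \<Rightarrow> real) \<Rightarrow> real \<Rightarrow> real set" where
  "regular_subgradients f x =
     {v. 0 \<le> Liminf (at x) (\<lambda>y. ereal ((f y - f x - v * (y - x)) / \<bar>y - x\<bar>))}"

definition subgradients :: "(real \<Rightarrow> real) \<Rightarrow> real \<Rightarrow> real set" where
  "subgradients f x =
     {v. \<exists>X V. X \<longlonglongrightarrow> x \<and> (\<lambda>n. f (X n)) \<longlonglongrightarrow> f x \<and>
               (\<forall>n. V n \<in> regular_subgradients f (X n)) \<and> V \<longlonglongrightarrow> v}"

text \<open>The regularization parameter \<open>l\<close> is nonnegative. At \<open>l = 0\<close> the function vanishes, so
all further requirements are only imposed for \<open>l > 0\<close>. The constant \<open>\<mu>\<close> may be negative and may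
depend on \<open>l\<close>.

Monotonicity is only required on the nonnegative half-line and no symmetry is assumed, so a
\<^const>\<open>subgradients\<close> set at zero need not contain zero: the linear function \<open>f x l = l * x\<close> is an
example. For it zero does not minimize \<open>x\<^sup>2 / 2 + f x l\<close>, and the decoupling over groups breaks
down. Results about these penalties therefore need \<open>0 \<in> subgradients (\<lambda>x. f x l) 0\<close>
separately; even penalties satisfy it.\<close>

definition penalty :: "(real \<Rightarrow> real \<Rightarrow> real) \<Rightarrow> bool" where
  "penalty f \<longleftrightarrow>
     (\<forall>x. f x 0 = 0) \<and>
     (\<forall>l>0.
        continuous_on UNIV (\<lambda>x. f x l) \<and>
        mono_on {0..} (\<lambda>x. f x l) \<and>
        f 0 l = 0 \<and>
        (\<forall>x. x \<noteq> 0 \<longrightarrow> (\<lambda>x. f x l) differentiable (at x)) \<and>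
        (\<forall>z\<in>subgradients (\<lambda>x. f x l) 0. \<bar>z\<bar> \<le> l) \<and>
        (\<exists>\<mu>\<le>1/2. convex_on UNIV (\<lambda>x. f x l + \<mu> * x\<^sup>2)))"

definition homogeneous :: "(real \<Rightarrow> real \<Rightarrow> real) \<Rightarrow> bool" where
  "homogeneous f \<longleftrightarrow> (\<forall>\<alpha>>0. \<forall>l>0. \<forall>x. f (\<alpha> * x) (\<alpha> * l) = \<alpha>\<^sup>2 * f x l)"

definition scale_invariant :: "(real \<Rightarrow> real \<Rightarrow> real) \<Rightarrow> bool" where
  "scale_invariant f \<longleftrightarrow>
     (\<forall>\<alpha>>0. \<forall>l>0. \<forall>x. f (\<alpha> * x) l = f x (\<alpha> * l) \<and> f x (\<alpha> * l) = \<alpha> * f x l)"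

definition norm_penalty :: "(real \<Rightarrow> real \<Rightarrow> real) \<Rightarrow> real ^ 'n \<Rightarrow> real \<Rightarrow> real" where
  "norm_penalty f a l = f (norm a) l"

definition entry_penalty :: "(real \<Rightarrow> real \<Rightarrow> real) \<Rightarrow> real ^ 'n \<Rightarrow> real \<Rightarrow> real" where
  "entry_penalty f a l = (\<Sum>j\<in>UNIV. f (a $ j) l)"

definition sparse_group_objective ::
  "(real \<Rightarrow> real \<Rightarrow> real) \<Rightarrow> (real \<Rightarrow> real \<Rightarrow> real) \<Rightarrow> real \<Rightarrow> real \<Rightarrow>
   ('g::finite \<Rightarrow> 'n set) \<Rightarrow> real ^ 'n \<Rightarrow> real ^ 'n \<Rightarrow> real" where
  "sparse_group_objective f_g f_e lg le \<I> b a =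
     1/2 * (norm (b - a))\<^sup>2 + (\<Sum>j\<in>UNIV. f_g (norm (group_vec (\<I> j) a)) lg)
       + (\<Sum>i\<in>UNIV. f_e (a $ i) le)"

definition single_group_objective ::
  "(real \<Rightarrow> real \<Rightarrow> real) \<Rightarrow> (real \<Rightarrow> real \<Rightarrow> real) \<Rightarrow> real \<Rightarrow> real \<Rightarrow>
   real ^ 'n \<Rightarrow> real ^ 'n \<Rightarrow> real" where
  "single_group_objective f_g f_e lg le b a =
     1/2 * (norm (b - a))\<^sup>2 + norm_penalty f_g a lg + entry_penalty f_e a le"

end

theory Submission
  imports Defs
begin

text \<open>Since \<open>0\<close> is a subgradient of \<open>f_g\<close> and of \<open>f_e\<close> at \<open>0\<close>, semiconvexity yields
\<open>f x + x\<^sup>2 / 2 \<ge> 0\<close>. Scaling this bound makes \<open>f_e\<close>, which is positively homogeneous,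
nonnegative and convex. Truncating a vector to its group therefore strictly decreases the
objective of that group unless the vector is already supported there, so minimizing over each
group is the same as minimizing jointly.

For the composition, let \<open>u\<close> be the proximal point of the entry penalty \<open>E\<close>. Then \<open>b - u\<close> is a
subgradient of \<open>E\<close> at \<open>u\<close>, and by homogeneity it remains one at \<open>s u\<close> for every \<open>s \<ge> 0\<close>; the
proximity operator of the norm penalty only moves \<open>u\<close> along this ray.\<close>

section \<open>Existence of minimizers for quadratic plus nonnegative objectives\<close>

lemma mem_argmin_iff: "a \<in> argmin F \<longleftrightarrow> (\<forall>c. F a \<le> F c)"
  by (auto simp: argmin_def is_arg_min_def not_less)

text \<open>Far from \<open>b\<close> the quadratic term alone exceeds \<open>\<phi> b\<close>, the
  value of the objective at \<open>b\<close>, so a minimizer over a compact ball is global.\<close>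

lemma argmin_coercive_nonempty:
  fixes b :: "'a::euclidean_space" and \<phi> :: "'a \<Rightarrow> real"
  assumes "continuous_on UNIV \<phi>" and nonneg: "\<And>a. 0 \<le> \<phi> a"
  shows "argmin (\<lambda>a. 1/2 * (norm (b - a))\<^sup>2 + \<phi> a) \<noteq> {}"
proof -
  let ?F = "\<lambda>a. 1/2 * (norm (b - a))\<^sup>2 + \<phi> a"
  \<comment> \<open>As \<open>r\<close> is at least 1, a distance above \<open>r\<close> has square
    at least \<open>r\<close>, and half of \<open>r\<close> exceeds \<open>\<phi> b\<close>; no
    square root is needed.\<close>
  define r where "r = 1 + 2 * \<phi> b"
  have r: "1 \<le> r" using nonneg[of b] by (simp add: r_def)
  have "continuous_on (cball b r) ?F"
    using assms(1) by (intro continuous_intros) (auto intro: continuous_on_subset)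
  then obtain a where a: "\<And>c. c \<in> cball b r \<Longrightarrow> ?F a \<le> ?F c"
    using continuous_attains_inf[of "cball b r" ?F] r by fastforce
  have "?F a \<le> ?F c" for c
  proof (cases "c \<in> cball b r")
    case False
    then have "r < norm (b - c)" by (simp add: dist_norm)
    then have "r * 1 \<le> norm (b - c) * norm (b - c)" using r by (intro mult_mono) auto
    then have "r \<le> (norm (b - c))\<^sup>2" by (simp add: power2_eq_square)
    then have "\<phi> b \<le> ?F c" using nonneg[of c] by (simp add: r_def)
    moreover have "?F a \<le> \<phi> b" using a[of b] r by simp
    ultimately show ?thesis by simp
  qed (rule a)
  then have "a \<in> argmin ?F" unfolding mem_argmin_iff by blast
  then show ?thesis by blast
qed

section \<open>Semiconvexity and subgradients\<close>

lemma penalty_convex: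
  assumes "penalty f" "0 < l"
  shows "convex_on UNIV (\<lambda>x. f x l + x\<^sup>2 / 2)"
proof -
  obtain \<mu> where \<mu>: "\<mu> \<le> 1/2" "convex_on UNIV (\<lambda>x. f x l + \<mu> * x\<^sup>2)"
    using assms by (auto simp: penalty_def)
  \<comment> \<open>The added multiple of the square is convex because \<open>\<mu>\<close> is at
    most 1/2; the unknown modulus is thereby replaced by 1/2.\<close>
  have "convex_on UNIV (\<lambda>x. (f x l + \<mu> * x\<^sup>2) + (1/2 - \<mu>) * x\<^sup>2)"
    by (rule convex_on_add[OF \<mu>(2) convex_on_cmul[OF _ convex_power2]]) (use \<mu>(1) in simp)
  moreover have "(f x l + \<mu> * x\<^sup>2) + (1/2 - \<mu>) * x\<^sup>2 = f x l + x\<^sup>2 / 2" for x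
    by (simp add: field_simps)
  ultimately show ?thesis by simp
qed

text \<open>The lower limit in epsilon form, ready to be evaluated along a segment.\<close>

lemma regular_subgradient_bound:
  assumes "v \<in> regular_subgradients f x" "0 < e"
  shows "\<forall>\<^sub>F y in at x. v * (y - x) - e * \<bar>y - x\<bar> \<le> f y - f x"
proof -
  have "ereal (- e) < 0" using assms by simp
  also have "0 \<le> Liminf (at x) (\<lambda>y. ereal ((f y - f x - v * (y - x)) / \<bar>y - x\<bar>))"
    using assms by (simp add: regular_subgradients_def)
  finally have "\<forall>\<^sub>F y in at x. ereal (- e) < ereal ((f y - f x - v * (y - x)) / \<bar>y - x\<bar>)"
    by (rule less_LiminfD)
  moreover have "\<forall>\<^sub>F y in at x. y \<noteq> x" by (rule eventually_neq_at_within)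
  ultimately show ?thesis
    by eventually_elim (auto simp: less_divide_eq)
qed

text \<open>Convexity makes the local first-order inequality global: compare at points of the
  segment from \<open>x\<close> to \<open>y\<close> close to \<open>x\<close>, then divide by the
  parameter. The square contributes its derivative \<open>x\<close> to the slope.\<close>

lemma regular_subgradient_convex:
  assumes "convex_on UNIV (\<lambda>x. f x + x\<^sup>2 / 2)" "v \<in> regular_subgradients f x"
  shows "f x + x\<^sup>2 / 2 + (v + x) * (y - x) \<le> f y + y\<^sup>2 / 2"
proof (cases "y = x")
  case False
  let ?h = "\<lambda>x. f x + x\<^sup>2 / 2"
  have "(v + x) * (y - x) - (?h y - ?h x) \<le> 0 + e" if "0 < e" for e
  proof -
    \<comment> \<open>Scaled so that the error at parameter \<open>t\<close> on the segment is
      exactly \<open>t * e\<close>.\<close>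
    define d where "d = e / \<bar>y - x\<bar>"
    have d: "0 < d" "d * \<bar>y - x\<bar> = e" using that False by (auto simp: d_def)
    have "((\<lambda>t. x + t * (y - x)) \<longlongrightarrow> x + 0 * (y - x)) (at_right 0)"
      by (intro tendsto_intros)
    then have "filterlim (\<lambda>t. x + t * (y - x)) (at x) (at_right 0)"
      using False by (auto simp: filterlim_at eventually_at_right_less eventually_at_filter)
    from eventually_compose_filterlim[OF regular_subgradient_bound[OF assms(2) d(1)] this]
    have "\<forall>\<^sub>F t in at_right 0. 0 < t \<and> t < 1 \<and> v * (t * (y - x)) - d * \<bar>t * (y - x)\<bar>
            \<le> f (x + t * (y - x)) - f x"
      using eventually_at_right_less[of 0] eventually_at_right_real[of 0 1]
      by (auto elim: eventually_elim2)
    then obtain t where t: "0 < t" "t < 1"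
      "v * (t * (y - x)) - d * \<bar>t * (y - x)\<bar> \<le> f (x + t * (y - x)) - f x"
      using eventually_happens'[OF trivial_limit_at_right_real] by blast
    have "?h ((1 - t) * x + t * y) \<le> (1 - t) * ?h x + t * ?h y"
      using convex_onD[OF assms(1), of t x y] t by simp
    moreover have "(1 - t) * x + t * y = x + t * (y - x)" by (simp add: algebra_simps)
    ultimately have "?h (x + t * (y - x)) - ?h x \<le> t * (?h y - ?h x)"
      by (simp add: field_simps)
    moreover have "(x + t * (y - x))\<^sup>2 / 2 - x\<^sup>2 / 2 = t * (x * (y - x)) + (t * (y - x))\<^sup>2 / 2"
      by (simp add: power2_eq_square field_simps)
    moreover have "d * \<bar>t * (y - x)\<bar> = t * e"
      using t(1) d(2) by (simp add: abs_mult mult.left_commute)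
    moreover have "v * (t * (y - x)) = t * (v * (y - x))" by simp
    \<comment> \<open>The remainder \<open>(t * (y - x))\<^sup>2 / 2\<close> is nonnegative and is
      dropped; every other term carries a factor \<open>t\<close>.\<close>
    ultimately have "t * (v * (y - x)) + t * (x * (y - x)) - t * e \<le> t * (?h y - ?h x)"
      using t(3) zero_le_power2[of "t * (y - x)"] by linarith
    then have "t * ((v + x) * (y - x) - e) \<le> t * (?h y - ?h x)" by (simp add: algebra_simps)
    then show ?thesis using t(1) by simp
  qed
  then show ?thesis using field_le_epsilon[of "(v + x) * (y - x) - (?h y - ?h x)" 0] by fastforce
qed simp

text \<open>Zero is only a limiting subgradient, so the global inequality is applied at nearby
  points \<open>X n\<close> with regular subgradients \<open>V n\<close> and passed to the
  limit.\<close>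

lemma penalty_lower_bound:
  assumes "penalty f" "0 < l" "0 \<in> subgradients (\<lambda>x. f x l) 0"
  shows "0 \<le> f x l + x\<^sup>2 / 2"
proof -
  obtain X V where X: "X \<longlonglongrightarrow> 0" "(\<lambda>n. f (X n) l) \<longlonglongrightarrow> f 0 l" "V \<longlonglongrightarrow> 0"
    and V: "\<And>n. V n \<in> regular_subgradients (\<lambda>x. f x l) (X n)"
    using assms(3) by (auto simp: subgradients_def)
  have "(\<lambda>n. f (X n) l + (X n)\<^sup>2 / 2 + (V n + X n) * (x - X n))
          \<longlonglongrightarrow> f 0 l + 0\<^sup>2 / 2 + (0 + 0) * (x - 0)"
    by (intro tendsto_intros X) auto
  moreover have "f (X n) l + (X n)\<^sup>2 / 2 + (V n + X n) * (x - X n) \<le> f x l + x\<^sup>2 / 2" for n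
    by (rule regular_subgradient_convex[OF penalty_convex[OF assms(1,2)] V])
  ultimately have "f 0 l + 0\<^sup>2 / 2 + (0 + 0) * (x - 0) \<le> f x l + x\<^sup>2 / 2"
    by (intro LIMSEQ_le_const2) auto
  then show ?thesis using assms by (simp add: penalty_def)
qed

section \<open>Pointwise facts and positively homogeneous penalties\<close>

lemma penalty_continuous: "penalty f \<Longrightarrow> 0 < l \<Longrightarrow> continuous_on UNIV (\<lambda>x. f x l)"
  by (auto simp: penalty_def)

lemma penalty_zero: "penalty f \<Longrightarrow> 0 < l \<Longrightarrow> f 0 l = 0"
  by (auto simp: penalty_def)

lemma penalty_mono: "penalty f \<Longrightarrow> 0 < l \<Longrightarrow> 0 \<le> x \<Longrightarrow> x \<le> y \<Longrightarrow> f x l \<le> f y l"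
  by (auto simp: penalty_def mono_on_def)

lemma penalty_nonneg: "penalty f \<Longrightarrow> 0 < l \<Longrightarrow> 0 \<le> x \<Longrightarrow> 0 \<le> f x l"
  using penalty_mono[of f l 0 x] by (simp add: penalty_zero)

lemma scale_invariant_homogeneous:
  "scale_invariant f \<Longrightarrow> 0 < l \<Longrightarrow> 0 < \<alpha> \<Longrightarrow> f (\<alpha> * x) l = \<alpha> * f x l"
  by (auto simp: scale_invariant_def)

text \<open>The lower bound at \<open>\<alpha> * x\<close>, divided by \<open>\<alpha>\<close>, has
  a quadratic term of order \<open>\<alpha>\<close>, which vanishes as \<open>\<alpha>\<close> tends
  to 0 from the right.\<close>

lemma scale_invariant_nonneg:
  assumes "penalty f" "scale_invariant f" "0 < l" "0 \<in> subgradients (\<lambda>x. f x l) 0"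
  shows "0 \<le> f x l"
proof -
  have "0 \<le> \<alpha> * f x l + (\<alpha> * x)\<^sup>2 / 2" if "0 < \<alpha>" for \<alpha>
    using penalty_lower_bound[OF assms(1,3,4), of "\<alpha> * x"] that assms
    by (simp add: scale_invariant_homogeneous)
  then have "0 \<le> \<alpha> * (f x l + \<alpha> * (x\<^sup>2 / 2))" if "0 < \<alpha>" for \<alpha>
    using that by (simp add: algebra_simps power2_eq_square)
  then have *: "0 \<le> f x l + \<alpha> * (x\<^sup>2 / 2)" if "0 < \<alpha>" for \<alpha>
    using that by (simp add: zero_le_mult_iff)
  have "((\<lambda>\<alpha>. f x l + \<alpha> * (x\<^sup>2 / 2)) \<longlongrightarrow> f x l + 0 * (x\<^sup>2 / 2)) (at_right 0)"
    by (intro tendsto_intros)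
  moreover have "\<forall>\<^sub>F \<alpha> in at_right 0. 0 \<le> f x l + \<alpha> * (x\<^sup>2 / 2)"
    using eventually_at_right_less[of 0] by eventually_elim (rule *)
  ultimately show ?thesis
    using tendsto_lowerbound trivial_limit_at_right_real by fastforce
qed

lemma scale_invariant_convex:
  assumes "penalty f" "scale_invariant f" "0 < l" "0 \<in> subgradients (\<lambda>x. f x l) 0"
  shows "convex_on UNIV (\<lambda>x. f x l)"
proof -
  let ?c = "f 1 l" and ?d = "f (- 1) l"
  have nn: "0 \<le> ?c" "0 \<le> ?d" using scale_invariant_nonneg[OF assms] by auto
  have pos: "f x l = x * ?c" if "0 < x" for x
    using scale_invariant_homogeneous[OF assms(2,3) that, of 1] by simp
  have neg: "f x l = - x * ?d" if "x < 0" for x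
    using scale_invariant_homogeneous[OF assms(2,3), of "- x" "- 1"] that by simp
  \<comment> \<open>A positively homogeneous function on the line is linear on each half-line;
    \<open>p\<close> and \<open>q\<close> are the coefficients of its even and odd parts. Convexity
    comes down to \<open>p\<close> being nonnegative.\<close>
  define p q where "p = (?c + ?d) / 2" and "q = (?c - ?d) / 2"
  have f: "f x l = p * \<bar>x\<bar> + q * x" for x
    using pos[of x] neg[of x] penalty_zero[OF assms(1,3)]
    by (cases x "0::real" rule: linorder_cases) (simp_all add: p_def q_def field_simps)
  show ?thesis
  proof (rule convex_onI)
    fix t x y :: real assume t: "0 < t" "t < 1"
    have "\<bar>(1 - t) * x + t * y\<bar> \<le> (1 - t) * \<bar>x\<bar> + t * \<bar>y\<bar>"
      using abs_triangle_ineq[of "(1 - t) * x" "t * y"] t by (simp add: abs_mult)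
    then have "p * \<bar>(1 - t) * x + t * y\<bar> \<le> p * ((1 - t) * \<bar>x\<bar> + t * \<bar>y\<bar>)"
      using nn by (intro mult_left_mono) (simp_all add: p_def)
    then show "f ((1 - t) *\<^sub>R x + t *\<^sub>R y) l \<le> (1 - t) * f x l + t * f y l"
      by (simp add: f algebra_simps)
  qed simp
qed

section \<open>Penalties on vectors and existence of their proximal points\<close>

lemma entry_penalty_continuous:
  assumes "penalty f" "0 < l"
  shows "continuous_on UNIV (\<lambda>a. entry_penalty f a l)"
  unfolding entry_penalty_def
  by (intro continuous_intros continuous_on_compose2[OF penalty_continuous[OF assms]]) auto

lemma entry_penalty_nonneg:
  assumes "penalty f" "scale_invariant f" "0 < l" "0 \<in> subgradients (\<lambda>x. f x l) 0"
  shows "0 \<le> entry_penalty f a l"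
  unfolding entry_penalty_def by (intro sum_nonneg scale_invariant_nonneg[OF assms])

lemma entry_penalty_convex:
  assumes "penalty f" "scale_invariant f" "0 < l" "0 \<in> subgradients (\<lambda>x. f x l) 0"
    and "0 \<le> t" "t \<le> 1"
  shows "entry_penalty f ((1 - t) *\<^sub>R x + t *\<^sub>R y) l \<le> (1 - t) * entry_penalty f x l + t * entry_penalty f y l"
proof -
  have "f ((1 - t) * x $ j + t * y $ j) l \<le> (1 - t) * f (x $ j) l + t * f (y $ j) l" for j
    using convex_onD[OF scale_invariant_convex[OF assms(1-4)] assms(5,6)] by simp
  then show ?thesis
    unfolding entry_penalty_def by (simp add: sum_distrib_left flip: sum.distrib) (rule sum_mono)
qed

lemma entry_penalty_scale:
  assumes "penalty f" "scale_invariant f" "0 < l" "0 \<le> t"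
  shows "entry_penalty f (t *\<^sub>R x) l = t * entry_penalty f x l"
  using assms
  \<comment> \<open>Scale invariance covers only positive factors; at \<open>t = 0\<close> every
    entry contributes \<open>f 0 l = 0\<close>.\<close>
  by (cases "t = 0")
    (simp_all add: entry_penalty_def penalty_zero scale_invariant_homogeneous sum_distrib_left)

lemma norm_penalty_continuous:
  assumes "penalty f" "0 < l"
  shows "continuous_on UNIV (\<lambda>a. norm_penalty f a l)"
  unfolding norm_penalty_def
  by (intro continuous_intros continuous_on_compose2[OF penalty_continuous[OF assms]]) auto

lemma norm_penalty_nonneg: "penalty f \<Longrightarrow> 0 < l \<Longrightarrow> 0 \<le> norm_penalty f a l"
  by (simp add: norm_penalty_def penalty_nonneg)

lemma prox_norm_penalty_nonempty:
  "penalty f \<Longrightarrow> 0 < l \<Longrightarrow> prox l (norm_penalty f) v \<noteq> {}"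
  unfolding prox_def
  by (rule argmin_coercive_nonempty) (simp_all add: norm_penalty_continuous norm_penalty_nonneg)

lemma prox_entry_penalty_nonempty:
  assumes "penalty f" "scale_invariant f" "0 < l" "0 \<in> subgradients (\<lambda>x. f x l) 0"
  shows "prox l (entry_penalty f) v \<noteq> {}"
  unfolding prox_def
  by (rule argmin_coercive_nonempty)
    (simp_all add: entry_penalty_continuous entry_penalty_nonneg assms)

section \<open>The proximity operator of the norm penalty\<close>

lemma prox_norm_penalty_zero:
  assumes "penalty f" "0 < l"
  shows "prox l (norm_penalty f) (0 :: real ^ 'n) = {0}"
proof -
  have "a = 0" if "\<And>c. (norm a)\<^sup>2 / 2 + f (norm a) l \<le> (norm c)\<^sup>2 / 2 + f (norm c) l" for a :: "real ^ 'n"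
    using that[of 0] penalty_nonneg[OF assms, of "norm a"] penalty_zero[OF assms]
    by (auto simp: add_nonneg_eq_0_iff dest: order_antisym)
  moreover have "0 \<le> (norm c)\<^sup>2 / 2 + f (norm c) l" for c :: "real ^ 'n"
    using penalty_nonneg[OF assms, of "norm c"] by simp
  ultimately have "a \<in> prox l (norm_penalty f) 0 \<longleftrightarrow> a = 0" for a :: "real ^ 'n"
    using penalty_zero[OF assms] unfolding prox_def mem_argmin_iff norm_penalty_def
    by auto
  then show ?thesis by blast
qed

text \<open>For \<open>s < 0\<close> the objective exceeds its value at \<open>0\<close> by at least \<open>- t * s\<close>.\<close>
lemma prox_scalar_nonneg:
  assumes "penalty f" "0 < l" "0 \<in> subgradients (\<lambda>x. f x l) 0" "0 < t" "s \<in> prox l f t"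
  shows "0 \<le> s"
proof (rule ccontr)
  assume "\<not> 0 \<le> s"
  then have "t * s < 0" using \<open>0 < t\<close> by (simp add: mult_less_0_iff)
  moreover have "(t - s)\<^sup>2 / 2 + f s l \<le> t\<^sup>2 / 2"
    using assms penalty_zero[OF assms(1,2)] by (force simp: prox_def mem_argmin_iff dest: spec[of _ 0])
  ultimately show False
    using penalty_lower_bound[OF assms(1-3), of s] by (simp add: power2_diff field_simps)
qed

lemma norm_diff_square:
  fixes a b :: "'a::real_inner"
  shows "(norm (a - b))\<^sup>2 = (norm a)\<^sup>2 - 2 * (a \<bullet> b) + (norm b)\<^sup>2"
  by (simp add: power2_norm_eq_inner inner_diff_left inner_diff_right inner_commute)

text \<open>The reverse triangle inequality, squared to match the objectives.\<close>

lemma norm_diff_ge_norm_diff: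
  fixes a v :: "'a::real_inner"
  shows "(norm v - norm a)\<^sup>2 \<le> (norm (v - a))\<^sup>2"
  using norm_cauchy_schwarz[of v a] by (simp add: norm_diff_square power2_diff)

text \<open>The equality case of Cauchy-Schwarz puts \<open>a\<close> on the ray through
  \<open>v\<close>.\<close>

lemma norm_diff_eq_norm_diff:
  fixes a v :: "'a::real_inner"
  assumes "(norm (v - a))\<^sup>2 \<le> (norm v - norm a)\<^sup>2" "v \<noteq> 0"
  shows "a = (norm a / norm v) *\<^sub>R v"
proof -
  have "v \<bullet> a = norm v * norm a"
    using assms norm_cauchy_schwarz[of v a] by (simp add: norm_diff_square power2_diff)
  then have "norm v *\<^sub>R a = norm a *\<^sub>R v" by (simp add: norm_cauchy_schwarz_eq)
  then have "(1 / norm v) *\<^sub>R (norm v *\<^sub>R a) = (1 / norm v) *\<^sub>R (norm a *\<^sub>R v)" by simp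
  then show ?thesis using assms(2) by simp
qed

text \<open>Moving a vector to the ray through \<open>v\<close> without changing its norm does not
  increase the objective, which on that ray is the scalar objective at nonnegative arguments. Scalar
  proximal points are nonnegative, so the restriction loses none of them.\<close>

lemma prox_norm_penalty:
  fixes v :: "real ^ 'n"
  assumes "penalty f" "0 < l" "0 \<in> subgradients (\<lambda>x. f x l) 0"
  shows "prox l (norm_penalty f) v =
    (if v = 0 then {0} else (\<lambda>s. (s / norm v) *\<^sub>R v) ` prox l f (norm v))"
proof (cases "v = 0")
  case False
  let ?r = "\<lambda>s. (s / norm v) *\<^sub>R v"
  let ?F = "\<lambda>a. (norm (v - a))\<^sup>2 / 2 + f (norm a) l"
  let ?p = "\<lambda>s. (norm v - s)\<^sup>2 / 2 + f s l"
  have F: "a \<in> prox l (norm_penalty f) v \<longleftrightarrow> (\<forall>c. ?F a \<le> ?F c)" for a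
    by (simp add: prox_def mem_argmin_iff norm_penalty_def)
  have p: "s \<in> prox l f (norm v) \<longleftrightarrow> (\<forall>t. ?p s \<le> ?p t)" for s
    by (simp add: prox_def mem_argmin_iff)
  have norm_r: "norm (?r s) = s" if "0 \<le> s" for s using that False by simp
  have Fr: "?F (?r s) = ?p s" if "0 \<le> s" for s
  proof -
    have "v - ?r s = ((norm v - s) / norm v) *\<^sub>R v"
      using False by (simp add: diff_divide_distrib scaleR_diff_left)
    then have "norm (v - ?r s) = \<bar>norm v - s\<bar>" using False by simp
    then show ?thesis by (simp add: norm_r[OF that] del: norm_scaleR)
  qed
  have Fge: "?p (norm a) \<le> ?F a" for a
    using norm_diff_ge_norm_diff[of v a] by simp
  have "prox l (norm_penalty f) v = ?r ` prox l f (norm v)"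
  proof (intro set_eqI iffI)
    fix a assume "a \<in> ?r ` prox l f (norm v)"
    then obtain s where s: "s \<in> prox l f (norm v)" "a = ?r s" by auto
    have "0 \<le> s" using prox_scalar_nonneg[OF assms _ s(1)] False by simp
    show "a \<in> prox l (norm_penalty f) v"
      unfolding F
    proof (rule allI)
      fix c :: "real ^ 'n"
      have "?F a = ?p s" using Fr[OF \<open>0 \<le> s\<close>] s(2) by simp
      also have "\<dots> \<le> ?p (norm c)" using s(1) unfolding p by blast
      also have "\<dots> \<le> ?F c" by (rule Fge)
      finally show "?F a \<le> ?F c" .
    qed
  next
    fix a assume a: "a \<in> prox l (norm_penalty f) v"
    \<comment> \<open>Both vectors have the same norm, so the penalties cancel and only the
      distances to \<open>v\<close> are compared.\<close>
    then have "?F a \<le> ?F (?r (norm a))" unfolding F by blast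
    then have "(norm (v - a))\<^sup>2 \<le> (norm v - norm a)\<^sup>2" using Fr[of "norm a"] by simp
    then have ar: "a = ?r (norm a)" using norm_diff_eq_norm_diff False by blast
    have nonneg: "?p (norm a) \<le> ?p t" if "0 \<le> t" for t
      using a[unfolded F, rule_format, of "?r t"] Fge[of a] Fr[OF that] by simp
    have "?p (norm a) \<le> ?p t" for t
    \<comment> \<open>Vectors realize only nonnegative \<open>t\<close>. For negative
      \<open>t\<close> the scalar objective is at least its value at 0.\<close>
    proof (cases "0 \<le> t")
      case False
      have "norm v * t \<le> 0" using False by (simp add: mult_nonneg_nonpos)
      then have "?p 0 \<le> ?p t"
        using penalty_lower_bound[OF assms, of t] penalty_zero[OF assms(1,2)]
        by (simp add: power2_diff field_simps)
      then show ?thesis using nonneg[of 0] by simp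
    qed (rule nonneg)
    then show "a \<in> ?r ` prox l f (norm v)" using ar p by blast
  qed
  then show ?thesis using False by simp
qed (simp add: prox_norm_penalty_zero assms)

section \<open>Entrywise proximal points and their composition with the norm penalty\<close>

lemma norm_square_vec: "(norm (x :: real ^ 'n))\<^sup>2 = (\<Sum>j\<in>UNIV. (x $ j)\<^sup>2)"
  unfolding power2_norm_eq_inner inner_vec_def by (simp add: power2_eq_square)

text \<open>The summands share no variable, so varying one entry of a minimizer isolates the
  corresponding \<open>p j\<close>.\<close>

lemma argmin_separable:
  fixes p :: "'n::finite \<Rightarrow> real \<Rightarrow> real"
  shows "argmin (\<lambda>a :: real ^ 'n. \<Sum>j\<in>UNIV. p j (a $ j)) = {a. \<forall>j. a $ j \<in> argmin (p j)}"
proof (intro set_eqI iffI)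
  fix a :: "real ^ 'n" assume a: "a \<in> argmin (\<lambda>a. \<Sum>j\<in>UNIV. p j (a $ j))"
  have "p j (a $ j) \<le> p j t" for j t
  proof -
    let ?c = "\<chi> k. if k = j then t else a $ k"
    have "(\<Sum>k\<in>UNIV. p k (a $ k)) \<le> (\<Sum>k\<in>UNIV. p k (?c $ k))"
      using a unfolding mem_argmin_iff by blast
    then have "p j (a $ j) + (\<Sum>k\<in>UNIV - {j}. p k (a $ k)) \<le> p j t + (\<Sum>k\<in>UNIV - {j}. p k (?c $ k))"
      by (simp add: sum.remove[of UNIV j])
    moreover have "(\<Sum>k\<in>UNIV - {j}. p k (?c $ k)) = (\<Sum>k\<in>UNIV - {j}. p k (a $ k))"
      by (rule sum.cong) auto
    ultimately show ?thesis by simp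
  qed
  then show "a \<in> {a. \<forall>j. a $ j \<in> argmin (p j)}" by (simp add: mem_argmin_iff)
qed (auto simp: mem_argmin_iff intro: sum_mono)

lemma prox_entry_penalty:
  "prox l (entry_penalty f) v = {a. \<forall>j. a $ j \<in> prox l f (v $ j)}"
proof -
  have "1/2 * (norm (v - a))\<^sup>2 + entry_penalty f a l
      = (\<Sum>j\<in>UNIV. 1/2 * (norm (v $ j - a $ j))\<^sup>2 + f (a $ j) l)" for a
    by (simp add: norm_square_vec entry_penalty_def sum.distrib sum_distrib_left)
  then show ?thesis
    using argmin_separable[of "\<lambda>j t. 1/2 * (norm (v $ j - t))\<^sup>2 + f t l"] by (simp add: prox_def)
qed

text \<open>Fermat's rule for a convex penalty: compare \<open>u\<close> with points on the segment
  towards \<open>a\<close>, divide by the parameter \<open>t\<close>, and let \<open>t\<close> tend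
  to 0.\<close>

lemma prox_entry_penalty_subgradient:
  assumes f: "penalty f" "scale_invariant f" "0 < l" "0 \<in> subgradients (\<lambda>x. f x l) 0"
    and u: "u \<in> prox l (entry_penalty f) b"
  shows "entry_penalty f u l + (b - u) \<bullet> (a - u) \<le> entry_penalty f a l"
proof -
  let ?E = "\<lambda>a. entry_penalty f a l"
  have *: "0 \<le> - ((b - u) \<bullet> (a - u)) + t * ((norm (a - u))\<^sup>2 / 2) + (?E a - ?E u)"
    if t: "0 < t" "t < 1" for t
  proof -
    let ?c = "(1 - t) *\<^sub>R u + t *\<^sub>R a"
    have "(norm (b - u))\<^sup>2 / 2 + ?E u \<le> (norm (b - ?c))\<^sup>2 / 2 + ?E ?c"
      using u by (simp add: prox_def mem_argmin_iff)
    moreover have c: "b - ?c = (b - u) - t *\<^sub>R (a - u)" by (simp add: algebra_simps)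
    have "(norm (b - ?c))\<^sup>2 = (norm (b - u))\<^sup>2 - 2 * (t * ((b - u) \<bullet> (a - u))) + t\<^sup>2 * (norm (a - u))\<^sup>2"
      unfolding c by (simp add: norm_diff_square[of "b - u"] power_mult_distrib)
    moreover have "?E ?c \<le> (1 - t) * ?E u + t * ?E a"
      by (rule entry_penalty_convex[OF f]) (use t in auto)
    ultimately have "0 \<le> t * (- ((b - u) \<bullet> (a - u)) + t * ((norm (a - u))\<^sup>2 / 2) + (?E a - ?E u))"
      by (simp add: algebra_simps power2_eq_square)
    then show ?thesis using t by (simp add: zero_le_mult_iff)
  qed
  have "((\<lambda>t. - ((b - u) \<bullet> (a - u)) + t * ((norm (a - u))\<^sup>2 / 2) + (?E a - ?E u))
      \<longlongrightarrow> - ((b - u) \<bullet> (a - u)) + 0 * ((norm (a - u))\<^sup>2 / 2) + (?E a - ?E u)) (at_right 0)"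
    by (intro tendsto_intros)
  moreover have "\<forall>\<^sub>F t in at_right 0.
      0 \<le> - ((b - u) \<bullet> (a - u)) + t * ((norm (a - u))\<^sup>2 / 2) + (?E a - ?E u)"
    using eventually_at_right_real[OF zero_less_one] by eventually_elim (rule *, auto)
  ultimately have "0 \<le> - ((b - u) \<bullet> (a - u)) + 0 * ((norm (a - u))\<^sup>2 / 2) + (?E a - ?E u)"
    using tendsto_lowerbound trivial_limit_at_right_real by blast
  then show ?thesis by simp
qed

text \<open>The subgradient inequality bounds the full objective below by the objective of the outer
proximity operator plus a constant, with equality on the ray spanned by \<open>u\<close>, which contains
all minimizers of the latter.\<close>
lemma argmin_single_group_prox:
  fixes b u :: "real ^ 'n"
  assumes g: "penalty f_g" "0 < lg" "0 \<in> subgradients (\<lambda>x. f_g x lg) 0"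
    and e: "penalty f_e" "scale_invariant f_e" "0 < le" "0 \<in> subgradients (\<lambda>x. f_e x le) 0"
    and u: "u \<in> prox le (entry_penalty f_e) b"
  shows "argmin (single_group_objective f_g f_e lg le b) = prox lg (norm_penalty f_g) u"
proof -
  let ?F = "single_group_objective f_g f_e lg le b"
  let ?E = "\<lambda>a. entry_penalty f_e a le"
  let ?H = "\<lambda>a. (norm (u - a))\<^sup>2 / 2 + norm_penalty f_g a lg"
  let ?k = "(norm (b - u))\<^sup>2 / 2 + ?E u"
  \<comment> \<open>Expanding the square around \<open>u\<close> leaves, in the last bracket, the
    slack of the subgradient inequality.\<close>
  have F: "?F a = ?H a + ?k + (?E a - ?E u - (b - u) \<bullet> (a - u))" for a
  proof -
    have "b - a = (b - u) - (a - u)" by simp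
    then have "(norm (b - a))\<^sup>2 = (norm (b - u))\<^sup>2 - 2 * ((b - u) \<bullet> (a - u)) + (norm (a - u))\<^sup>2"
      by (metis norm_diff_square)
    then show ?thesis
      by (simp add: single_group_objective_def norm_minus_commute[of u a] field_simps)
  qed
  have sub: "?E u + (b - u) \<bullet> (a - u) \<le> ?E a" for a
    by (rule prox_entry_penalty_subgradient[OF e u])
  have E: "?E (s *\<^sub>R u) = s * ?E u" if "0 \<le> s" for s
    by (rule entry_penalty_scale[OF e(1-3) that])
  \<comment> \<open>Testing at 0 and at twice \<open>u\<close> gives opposite inequalities. With
    this identity the slack vanishes at every \<open>s *\<^sub>R u\<close> with nonnegative
    \<open>s\<close>.\<close>
  have Eu: "?E u = (b - u) \<bullet> u"
    using sub[of 0] sub[of "2 *\<^sub>R u"] E[of 0] E[of 2]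
    by (simp add: inner_diff_right scaleR_2)
  have H: "a \<in> prox lg (norm_penalty f_g) u \<longleftrightarrow> (\<forall>c. ?H a \<le> ?H c)" for a
    by (simp add: prox_def mem_argmin_iff)
  have FH: "?F a = ?H a + ?k" if a: "a \<in> prox lg (norm_penalty f_g) u" for a
  proof -
    obtain s where s: "0 \<le> s" "a = s *\<^sub>R u"
    proof (cases "u = 0")
      case True
      then have "a = 0" using a prox_norm_penalty[OF g, of u] by simp
      then show ?thesis by (intro that[of 0]) simp_all
    next
      case False
      then obtain t where "t \<in> prox lg f_g (norm u)" "a = (t / norm u) *\<^sub>R u"
        using a prox_norm_penalty[OF g, of u] by auto
      moreover from this have "0 \<le> t" using prox_scalar_nonneg[OF g, of "norm u" t] False by simp
      ultimately show ?thesis by (intro that[of "t / norm u"]) auto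
    qed
    then show ?thesis using Eu E[of s] by (simp add: F inner_diff_right)
  qed
  have FHle: "?H a + ?k \<le> ?F a" for a using F[of a] sub[of a] by simp
  \<comment> \<open>At \<open>m\<close> the lower bound \<open>?H + ?k\<close> is attained, so a
    minimizer of \<open>?F\<close> cannot have a larger \<open>?H\<close> than
    \<open>m\<close>.\<close>
  obtain m where m: "m \<in> prox lg (norm_penalty f_g) u"
    using prox_norm_penalty_nonempty[OF g(1,2)] by blast
  show ?thesis
  proof (intro set_eqI iffI)
    fix a assume a: "a \<in> prox lg (norm_penalty f_g) u"
    then have "?F a \<le> ?F c" for c
      using FH[OF a] FHle[of c] H[of a] by (smt (verit))
    then show "a \<in> argmin ?F" by (simp add: mem_argmin_iff)
  next
    fix a assume "a \<in> argmin ?F"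
    then have "?F a \<le> ?F m" by (simp add: mem_argmin_iff)
    then have "?H a \<le> ?H m" using FH[OF m] FHle[of a] by simp
    then show "a \<in> prox lg (norm_penalty f_g) u" using m unfolding H by (meson order_trans)
  qed
qed

section \<open>Group vectors and decoupling\<close>

lemma group_vec_nth [simp]: "group_vec S a $ k = (if k \<in> S then a $ k else 0)"
  by (simp add: group_vec_def)

lemma group_vec_idem [simp]: "group_vec S (group_vec S a) = group_vec S a"
  by (simp add: vec_eq_iff)

lemma norm_group_vec_le: "norm (group_vec S a) \<le> norm a"
  by (rule norm_le_componentwise_cart) simp

text \<open>The data vanish off \<open>S\<close>, so by Pythagoras truncation saves half the squared
  norm of the discarded part. The norm penalty does not grow by monotonicity, nor the entry penalty
  by nonnegativity. The explicit gap later forces minimizers to be supported in their group.\<close>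

lemma single_group_objective_group_vec_le:
  assumes g: "penalty f_g" "0 < lg"
    and e: "penalty f_e" "scale_invariant f_e" "0 < le" "0 \<in> subgradients (\<lambda>x. f_e x le) 0"
  shows "single_group_objective f_g f_e lg le (group_vec S b) (group_vec S a)
      + (norm (a - group_vec S a))\<^sup>2 / 2
    \<le> single_group_objective f_g f_e lg le (group_vec S b) a"
proof -
  have "(norm (group_vec S b - a))\<^sup>2
      = (norm (group_vec S b - group_vec S a))\<^sup>2 + (norm (a - group_vec S a))\<^sup>2"
    unfolding norm_square_vec sum.distrib[symmetric] by (rule sum.cong) auto
  moreover have "norm_penalty f_g (group_vec S a) lg \<le> norm_penalty f_g a lg"
    unfolding norm_penalty_def by (rule penalty_mono[OF g norm_ge_zero norm_group_vec_le])
  moreover have "entry_penalty f_e (group_vec S a) le \<le> entry_penalty f_e a le"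
    unfolding entry_penalty_def
    by (rule sum_mono) (simp add: penalty_zero e scale_invariant_nonneg)
  ultimately show ?thesis by (simp add: single_group_objective_def add_divide_distrib)
qed

lemma sum_group:
  fixes \<I> :: "'g::finite \<Rightarrow> 'n::finite set" and p :: "'n \<Rightarrow> 'a::comm_monoid_add"
  assumes "disjoint_family \<I>" "(\<Union>i. \<I> i) = UNIV"
  shows "(\<Sum>i\<in>UNIV. \<Sum>k\<in>UNIV. if k \<in> \<I> i then p k else 0) = (\<Sum>k\<in>UNIV. p k)"
proof -
  have "(\<Sum>k\<in>UNIV. p k) = (\<Sum>k\<in>(\<Union>i\<in>UNIV. \<I> i). p k)" by (simp add: assms)
  also have "\<dots> = (\<Sum>i\<in>UNIV. \<Sum>k\<in>\<I> i. p k)"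
    using assms(1) by (intro sum.UNION_disjoint) (auto simp: disjoint_family_on_def)
  also have "\<dots> = (\<Sum>i\<in>UNIV. \<Sum>k\<in>UNIV. if k \<in> \<I> i then p k else 0)"
    by (simp add: sum.If_cases)
  finally show ?thesis by simp
qed

text \<open>Entries outside a group are set to 0 and cost nothing, since
  \<open>f_e 0 le = 0\<close>; each index is therefore charged once, in its own group.\<close>

lemma sparse_group_objective_decouple:
  fixes \<I> :: "'g::finite \<Rightarrow> 'n::finite set"
  assumes \<I>: "disjoint_family \<I>" "(\<Union>i. \<I> i) = UNIV" and "penalty f_e" "0 < le"
  shows "sparse_group_objective f_g f_e lg le \<I> b a =
    (\<Sum>i\<in>UNIV. single_group_objective f_g f_e lg le (group_vec (\<I> i) b) (group_vec (\<I> i) a))"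
proof -
  have "(norm (group_vec (\<I> i) b - group_vec (\<I> i) a))\<^sup>2
      = (\<Sum>k\<in>UNIV. if k \<in> \<I> i then (b $ k - a $ k)\<^sup>2 else 0)" for i
    unfolding norm_square_vec by (rule sum.cong) auto
  moreover have "entry_penalty f_e (group_vec (\<I> i) a) le
      = (\<Sum>k\<in>UNIV. if k \<in> \<I> i then f_e (a $ k) le else 0)" for i
    unfolding entry_penalty_def using assms(3,4) by (intro sum.cong) (auto simp: penalty_zero)
  ultimately show ?thesis
    by (simp add: sparse_group_objective_def single_group_objective_def norm_penalty_def sum.distrib
        sum_group[OF \<I>] norm_square_vec[of "b - a"] flip: sum_distrib_left sum_divide_distrib)
qed

text \<open>Being fixed by \<open>group_vec\<close> encodes support in the group; by disjointness
  only \<open>a j\<close> survives on group \<open>j\<close>.\<close>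

lemma group_vec_sum:
  fixes \<I> :: "'g::finite \<Rightarrow> 'n::finite set"
  assumes "disjoint_family \<I>" "\<And>i. group_vec (\<I> i) (a i) = a i"
  shows "group_vec (\<I> j) (\<Sum>i\<in>UNIV. a i) = a j"
proof -
  have "a i $ k = 0" if "k \<in> \<I> j" "i \<noteq> j" for i k
  proof -
    have "k \<notin> \<I> i" using assms(1) that by (auto simp: disjoint_family_on_def)
    then show ?thesis using assms(2)[of i] by (metis group_vec_nth)
  qed
  then have "(\<Sum>i\<in>UNIV. a i $ k) = a j $ k" if "k \<in> \<I> j" for k
    using that by (subst sum.remove[of _ j]) auto
  moreover have "a j $ k = 0" if "k \<notin> \<I> j" for k
    using assms(2)[of j] that by (metis group_vec_nth)
  ultimately show ?thesis by (simp add: vec_eq_iff)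
qed

lemma sum_group_vec:
  fixes \<I> :: "'g::finite \<Rightarrow> 'n::finite set"
  assumes \<I>: "disjoint_family \<I>" "(\<Union>i. \<I> i) = UNIV"
  shows "(\<Sum>i\<in>UNIV. group_vec (\<I> i) a) = a"
proof -
  have "(\<Sum>i\<in>UNIV. if k \<in> \<I> i then a $ k else 0) = a $ k" for k
  proof -
    obtain i where i: "k \<in> \<I> i" using \<I>(2) by auto
    then have "k \<notin> \<I> j" if "j \<noteq> i" for j
      using \<I>(1) that by (auto simp: disjoint_family_on_def)
    then show ?thesis using i by (subst sum.remove[of _ i]) auto
  qed
  then show ?thesis by (simp add: vec_eq_iff)
qed

theorem theorem1:
  fixes f_g f_e :: "real \<Rightarrow> real \<Rightarrow> real"
    and lg le :: real
    and b :: "real ^ 'n"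
    and \<I> :: "'g::finite \<Rightarrow> 'n set"
  assumes "penalty f_g" and "homogeneous f_g"
    and "penalty f_e" and "scale_invariant f_e"
    and "lg > 0" and "le > 0"
    and "0 \<in> subgradients (\<lambda>x. f_g x lg) 0"
    and "0 \<in> subgradients (\<lambda>x. f_e x le) 0"
    and "disjoint_family \<I>" and "(\<Union>i. \<I> i) = UNIV"
  shows
    "argmin (sparse_group_objective f_g f_e lg le \<I> b) \<noteq> {} \<and>
     argmin (sparse_group_objective f_g f_e lg le \<I> b) =
       {\<Sum>i\<in>UNIV. a i | a.
          \<forall>i. a i \<in> argmin (single_group_objective f_g f_e lg le (group_vec (\<I> i) b))} \<and>
     (\<forall>i. argmin (single_group_objective f_g f_e lg le (group_vec (\<I> i) b)) =
       group_vec (\<I> i) ` argmin (sparse_group_objective f_g f_e lg le \<I> b)) \<and>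
     (\<forall>i. argmin (single_group_objective f_g f_e lg le (group_vec (\<I> i) b)) =
       (\<Union>u\<in>prox le (entry_penalty f_e) (group_vec (\<I> i) b). prox lg (norm_penalty f_g) u)) \<and>
     (\<forall>v :: real ^ 'n. prox lg (norm_penalty f_g) v =
       (if v = 0 then {0} else (\<lambda>s. (s / norm v) *\<^sub>R v) ` prox lg f_g (norm v))) \<and>
     (\<forall>v :: real ^ 'n. prox le (entry_penalty f_e) v =
       {a. \<forall>j. a $ j \<in> prox le f_e (v $ j)})"
proof -
  note g = assms(1,5,7) and e = assms(3,4,6,8) and \<I> = assms(9,10)
  let ?F = "sparse_group_objective f_g f_e lg le \<I> b"
  let ?G = "\<lambda>i. single_group_objective f_g f_e lg le (group_vec (\<I> i) b)"
  have F: "?F a = (\<Sum>i\<in>UNIV. ?G i (group_vec (\<I> i) a))" for a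
    by (rule sparse_group_objective_decouple[OF \<I> e(1,3)])
  have G: "?G i (group_vec (\<I> i) a) + (norm (a - group_vec (\<I> i) a))\<^sup>2 / 2 \<le> ?G i a" for i a
    by (rule single_group_objective_group_vec_le[OF g(1,2) e])
  then have G_le: "?G i (group_vec (\<I> i) a) \<le> ?G i a" for i a
    by (smt (verit) zero_le_power2 divide_nonneg_nonneg)
  have supp: "group_vec (\<I> i) a = a" if "a \<in> argmin (?G i)" for i a
  proof -
    have "?G i a \<le> ?G i (group_vec (\<I> i) a)" using that by (simp add: mem_argmin_iff)
    then have "(norm (a - group_vec (\<I> i) a))\<^sup>2 \<le> 0" using G[of i a] by linarith
    then show ?thesis by simp
  qed
  \<comment> \<open>Every proximal point \<open>u\<close> yields the same set, so the union
    collapses once such a \<open>u\<close> exists.\<close>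
  have single: "argmin (?G i) =
      (\<Union>u\<in>prox le (entry_penalty f_e) (group_vec (\<I> i) b). prox lg (norm_penalty f_g) u)" for i
    using argmin_single_group_prox[OF g e, of _ "group_vec (\<I> i) b"]
      prox_entry_penalty_nonempty[OF e, of "group_vec (\<I> i) b"] by auto
  have nonempty: "argmin (?G i) \<noteq> {}" for i
    unfolding single using prox_entry_penalty_nonempty[OF e] prox_norm_penalty_nonempty[OF g(1,2)]
    by blast
  have sum_mem: "(\<Sum>i\<in>UNIV. a i) \<in> argmin ?F" if a: "\<And>i. a i \<in> argmin (?G i)" for a
  proof -
    have "?F (\<Sum>i\<in>UNIV. a i) = (\<Sum>i\<in>UNIV. ?G i (a i))"
      unfolding F using group_vec_sum[OF \<I>(1) supp[OF a]] by simp
    also have "\<dots> \<le> ?F c" for c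
      unfolding F using a by (intro sum_mono) (simp add: mem_argmin_iff)
    finally show ?thesis by (simp add: mem_argmin_iff)
  qed
  have group_mem: "group_vec (\<I> i) a \<in> argmin (?G i)" if a: "a \<in> argmin ?F" for i a
  proof -
    have "?G i (group_vec (\<I> i) a) \<le> ?G i c" for c
    proof -
      \<comment> \<open>The competitor takes \<open>c\<close> on group \<open>i\<close> and keeps
        \<open>a\<close> on all others, so every summand but the one for \<open>i\<close> cancels.
        \<open>G_le\<close> then passes from the truncation of \<open>c\<close> to
        \<open>c\<close>.\<close>
      define d where "d = (\<lambda>j. group_vec (\<I> j) (if j = i then c else a))"
      have d: "group_vec (\<I> j) (sum d UNIV) = d j" for j
        by (rule group_vec_sum[OF \<I>(1)]) (simp add: d_def)
      have "(\<Sum>j\<in>UNIV. ?G j (group_vec (\<I> j) a)) \<le> (\<Sum>j\<in>UNIV. ?G j (d j))"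
        using a[unfolded mem_argmin_iff, rule_format, of "sum d UNIV"] unfolding F d .
      moreover have "(\<Sum>j\<in>UNIV - {i}. ?G j (d j)) = (\<Sum>j\<in>UNIV - {i}. ?G j (group_vec (\<I> j) a))"
        by (rule sum.cong) (auto simp: d_def)
      ultimately have "?G i (group_vec (\<I> i) a) \<le> ?G i (d i)"
        by (simp add: sum.remove[of UNIV i])
      then show ?thesis using G_le[of i c] by (simp add: d_def)
    qed
    then show ?thesis by (simp add: mem_argmin_iff)
  qed
  \<comment> \<open>One minimizer per group: their sum shows that a joint minimizer exists, and they
    fill the other groups when a minimizer of a single group is extended to a joint one.\<close>
  define m where "m i = (SOME a. a \<in> argmin (?G i))" for i
  have m: "m i \<in> argmin (?G i)" for i
    unfolding m_def using nonempty[of i] by (simp add: some_in_eq)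
  have "argmin ?F = {\<Sum>i\<in>UNIV. a i | a. \<forall>i. a i \<in> argmin (?G i)}"
  proof (intro set_eqI iffI)
    fix c assume "c \<in> argmin ?F"
    then have "c = (\<Sum>i\<in>UNIV. group_vec (\<I> i) c)" "\<forall>i. group_vec (\<I> i) c \<in> argmin (?G i)"
      using group_mem by (simp_all add: sum_group_vec[OF \<I>])
    then show "c \<in> {\<Sum>i\<in>UNIV. a i | a. \<forall>i. a i \<in> argmin (?G i)}" by blast
  qed (use sum_mem in blast)
  moreover have "argmin (?G i) = group_vec (\<I> i) ` argmin ?F" for i
  proof (intro set_eqI iffI)
    fix c assume c: "c \<in> argmin (?G i)"
    define d where "d = m(i := c)"
    have d: "d j \<in> argmin (?G j)" for j using c m by (simp add: d_def)
    have "group_vec (\<I> i) (sum d UNIV) = c"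
      using group_vec_sum[OF \<I>(1) supp[OF d], of i] by (simp add: d_def)
    then show "c \<in> group_vec (\<I> i) ` argmin ?F" using sum_mem[OF d] by blast
  qed (use group_mem in blast)
  moreover have "argmin ?F \<noteq> {}" using sum_mem[OF m] by blast
  ultimately show ?thesis
    using single prox_norm_penalty[OF g] prox_entry_penalty by blast
qed

end
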